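(* Let $n\ge2$, $N\in\{1,\dots,n-1\}$, let $v\in\mathbb{R}^n$ with $v_1,\dots,v_N>0$ and $v_{N+1},\dots,v_n<0$, and let $x\in\mathbb{R}^n$ satisfy $$\frac{x_1}{v_1}<\frac{x_2}{v_2}<\dots<\frac{x_N}{v_N},\qquad \frac{x_n}{v_n}<\frac{x_{n-1}}{v_{n-1}}<\dots<\frac{x_{N+1}}{v_{N+1}}.$$ Then the projection algorithm described in the context, run on input $(x,v)$, terminates after finitely many steps, and its output $y$ is the Euclidean projection of $x$ onto the polyhedral cone $P:=\operatorname{span}\{v\}\oplus[0,\infty)^n$.
   Context: $\oplus$ is the Minkowski sum. One has $P=\{x\in\mathbb{R}^n: x_l/v_l\ge x_r/v_r\ \text{for all }1\le l\le N<r\le n\}$. Define $\bar L:=\{l\le N:\ x_l/v_l<x_r/v_r\text{ for some }r\in\{N+1,\dots,n\}\}$ and $\bar R:=\{r>N:\ x_l/v_l<x_r/v_r\text{ for some }l\in\{1,\dots,N\}\}$. For $L\subset\{1,\dots,N\}$, $R\subset\{N+1,\dots,n\}$ with $L\cup R\neq\emptyset$ define $\Sigma_{LR}:=\dfrac{\sum_{k\in L\cup R}x_kv_k}{\sum_{k\in L\cup R}v_k^2}$ and $y^{LR}\in\mathbb{R}^n$ by $y^{LR}_i:=v_i\Sigma_{LR}$ if $i\in L\cup R$ and $y_i^{LR}:=x_i$ otherwise. Projection algorithm: initialize $y\leftarrow x$, $L\leftarrow\{1\}$, $R\leftarrow\{N+1\}$. While $y\notin P$, do the following in order: (i) $y\leftarrow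 y^{LR}$; (ii) if $|L|<|\bar L|$ and $x_{|L|+1}/v_{|L|+1}<\Sigma_{LR}$, set $L\leftarrow L\cup\{|L|+1\}$; (iii) if $|R|<|\bar R|$ and $x_{N+|R|+1}/v_{N+|R|+1}>\Sigma_{LR}$, set $R\leftarrow R\cup\{N+|R|+1\}$. Return $y$ when the loop ends. *)

theory Defs
  imports "HOL-Analysis.Analysis" "HOL-Library.While_Combinator" "HOL-Library.Set_Algebras"
begin

text \<open>
  Vectors of \<open>\<real>\<^sup>n\<close> have type \<open>real ^ 'n\<close> with \<open>n = CARD('n)\<close>. A numbering
  \<open>e\<close> of the coordinates, a bijection from \<open>{1..CARD('n)}\<close> onto the index type, is carried along
  as a parameter: the coordinate \<open>x\<^sub>i\<close> is \<open>x $ e i\<close>, and the sets \<open>L\<close>, \<open>R\<close> of the algorithm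
  are sets of natural numbers.
\<close>

definition cone_P :: "real ^ 'n \<Rightarrow> (real ^ 'n) set" where
  "cone_P v = span {v} + {w. \<forall>j. 0 \<le> w $ j}"

definition L_bar :: "(nat \<Rightarrow> 'n) \<Rightarrow> nat \<Rightarrow> real ^ 'n \<Rightarrow> real ^ 'n \<Rightarrow> nat set" where
  "L_bar e N v x =
     {l \<in> {1..N}. \<exists>r\<in>{N+1..CARD('n)}. x $ e l / v $ e l < x $ e r / v $ e r}"

definition R_bar :: "(nat \<Rightarrow> 'n) \<Rightarrow> nat \<Rightarrow> real ^ 'n \<Rightarrow> real ^ 'n \<Rightarrow> nat set" where
  "R_bar e N v x =
     {r \<in> {N+1..CARD('n)}. \<exists>l\<in>{1..N}. x $ e l / v $ e l < x $ e r / v $ e r}"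

definition Sigma_LR :: "(nat \<Rightarrow> 'n) \<Rightarrow> real ^ 'n \<Rightarrow> real ^ 'n \<Rightarrow> nat set \<Rightarrow> nat set \<Rightarrow> real" where
  "Sigma_LR e v x L R =
     (\<Sum>k\<in>L \<union> R. x $ e k * v $ e k) / (\<Sum>k\<in>L \<union> R. (v $ e k)\<^sup>2)"

definition y_LR :: "(nat \<Rightarrow> 'n) \<Rightarrow> real ^ 'n \<Rightarrow> real ^ 'n \<Rightarrow> nat set \<Rightarrow> nat set \<Rightarrow> real ^ 'n" where
  "y_LR e v x L R =
     (\<chi> j. if j \<in> e ` (L \<union> R) then v $ j * Sigma_LR e v x L R else x $ j)"

text \<open>
  The three assignments of the loop body are executed one after the other, so the test that
  guards the update of \<open>R\<close> already refers to the updated set \<open>L'\<close>.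
\<close>

definition proj_step ::
  "(nat \<Rightarrow> 'n) \<Rightarrow> nat \<Rightarrow> real ^ 'n \<Rightarrow> real ^ 'n \<Rightarrow>
     (real ^ 'n) \<times> nat set \<times> nat set \<Rightarrow> (real ^ 'n) \<times> nat set \<times> nat set" where
  "proj_step e N v x = (\<lambda>(y, L, R).
     let
       y' = y_LR e v x L R;
       l = card L + 1;
       L' = (if card L < card (L_bar e N v x) \<and> x $ e l / v $ e l < Sigma_LR e v x L R
             then L \<union> {l} else L);
       r = N + card R + 1;
       R' = (if card R < card (R_bar e N v x) \<and> x $ e r / v $ e r > Sigma_LR e v x L' R
             then R \<union> {r} else R)
     in (y', L', R'))"

text \<open>
  The result is \<open>None\<close> iff the loop does not terminate.
\<close>

definition projection_algorithm ::
  "(nat \<Rightarrow> 'n) \<Rightarrow> nat \<Rightarrow> real ^ 'n \<Rightarrow> real ^ 'n \<Rightarrow> (real ^ 'n) option" where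
  "projection_algorithm e N v x =
     map_option fst
       (while_option (\<lambda>(y, L, R). y \<notin> cone_P v) (proj_step e N v x) (x, {1}, {N+1}))"

end

theory Submission
  imports Defs
begin

text \<open>
  Put \<open>a\<^sub>k = x\<^sub>k / v\<^sub>k\<close>. The number \<open>\<Sigma>\<^sub>L\<^sub>R\<close> is the average of the \<open>a\<^sub>k\<close>, \<open>k \<in> L \<union> R\<close>, with
  weights \<open>v\<^sub>k\<^sup>2\<close>, and the loop maintains \<open>a\<^sub>l < \<Sigma>\<^sub>L\<^sub>R < a\<^sub>r\<close> for \<open>l \<in> L\<close>, \<open>r \<in> R\<close>: a new index
  pulls the average towards the new value without crossing it, and that value is extremal on its
  side. Under this invariant \<open>x - y\<^sup>L\<^sup>R\<close> is orthogonal to \<open>v\<close> and to \<open>y\<^sup>L\<^sup>R\<close> and has nonpositive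
  coordinates, so it lies in the polar cone of \<open>P\<close>; hence \<open>y\<^sup>L\<^sup>R\<close> is the projection as soon as it
  belongs to \<open>P\<close>. If it does not, then some index outside \<open>L \<union> R\<close> lies on the wrong side of
  \<open>\<Sigma>\<^sub>L\<^sub>R\<close>, and by monotonicity so does the next candidate, which makes \<open>L\<close> or \<open>R\<close> grow.
\<close>

section \<open>Projections, the cone and weighted averages\<close>

text \<open>The obtuse angle at \<open>y\<close> turns the law of cosines into a Pythagorean
  inequality. It gives minimality of \<open>y\<close> and forces \<open>dist y z = 0\<close> for any
  other minimiser \<open>z\<close>, which settles the choice in
  \<open>closest_point\<close>.\<close>

lemma closest_point_eqI:
  fixes x y :: "'a::{real_inner,heine_borel}"
  assumes y: "y \<in> S" and obtuse: "\<And>z. z \<in> S \<Longrightarrow> inner (x - y) (z - y) \<le> 0"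
  shows "closest_point S x = y"
proof -
  have pythagoras: "(dist x y)\<^sup>2 + (dist y z)\<^sup>2 \<le> (dist x z)\<^sup>2" if "z \<in> S" for z
  proof -
    have "(dist x z)\<^sup>2 = (dist x y)\<^sup>2 + (dist y z)\<^sup>2 - 2 * inner (x - y) (z - y)"
      by (simp add: dist_norm power2_norm_eq_inner inner_diff inner_commute algebra_simps)
    then show ?thesis
      using obtuse[OF that] by simp
  qed
  show ?thesis
    unfolding closest_point_def
  proof (rule some_equality)
    show "y \<in> S \<and> (\<forall>z\<in>S. dist x y \<le> dist x z)"
    proof (intro conjI ballI)
      fix z assume "z \<in> S"
      then have "(dist x y)\<^sup>2 \<le> (dist x z)\<^sup>2"
        using pythagoras[of z] zero_le_power2[of "dist y z"] by linarith
      then show "dist x y \<le> dist x z"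
        by (rule power2_le_imp_le) simp
    qed (rule y)
  next
    fix z assume z: "z \<in> S \<and> (\<forall>u\<in>S. dist x z \<le> dist x u)"
    then have "(dist x z)\<^sup>2 \<le> (dist x y)\<^sup>2"
      using y by (intro power_mono) auto
    then have "(dist y z)\<^sup>2 \<le> 0"
      using pythagoras[of z] z by linarith
    then show "z = y"
      by simp
  qed
qed

text \<open>The witness \<open>t\<close> is the coefficient of \<open>v\<close> in a decomposition
  of \<open>y\<close>; the nonnegative part is \<open>y - t *\<^sub>R v\<close>.\<close>

lemma mem_cone_P_iff: "y \<in> cone_P v \<longleftrightarrow> (\<exists>t. \<forall>j. t * v $ j \<le> y $ j)"
proof
  assume "y \<in> cone_P v"
  then obtain t w where "y = t *\<^sub>R v + w" "\<forall>j. 0 \<le> w $ j"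
    by (auto simp: cone_P_def set_plus_def span_singleton)
  then show "\<exists>t. \<forall>j. t * v $ j \<le> y $ j"
    by (intro exI[of _ t]) auto
next
  assume "\<exists>t. \<forall>j. t * v $ j \<le> y $ j"
  then obtain t where t: "\<forall>j. t * v $ j \<le> y $ j" ..
  have "t *\<^sub>R v + (y - t *\<^sub>R v) \<in> cone_P v"
    unfolding cone_P_def using t
    by (intro set_plus_intro) (auto simp: span_singleton)
  then show "y \<in> cone_P v"
    by simp
qed

text \<open>Here \<open>s\<close> is an old average of total weight \<open>W\<close>, and
  \<open>a\<close> a new value of weight \<open>w\<close>.\<close>

lemma weighted_average_between:
  fixes s a w W :: real
  assumes "0 < w" "0 < W"
  shows "a < s \<Longrightarrow> a < (s * W + a * w) / (W + w) \<and> (s * W + a * w) / (W + w) < s"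
    and "s < a \<Longrightarrow> s < (s * W + a * w) / (W + w) \<and> (s * W + a * w) / (W + w) < a"
  using assms by (auto simp: field_simps)

section \<open>Input data and monotone quotients\<close>

locale projection_input =
  fixes e :: "nat \<Rightarrow> 'n::finite" and N :: nat and v x :: "real ^ 'n"
  assumes bij: "bij_betw e {1..CARD('n)} (UNIV :: 'n set)"
    and N: "1 \<le> N" "N < CARD('n)"
    and v_pos: "i \<in> {1..N} \<Longrightarrow> 0 < v $ e i"
    and v_neg: "i \<in> {N+1..CARD('n)} \<Longrightarrow> v $ e i < 0"
    and step_left: "i \<in> {1..<N} \<Longrightarrow> x $ e i / v $ e i < x $ e (i+1) / v $ e (i+1)"
    and step_right: "i \<in> {N+1..<CARD('n)} \<Longrightarrow> x $ e (i+1) / v $ e (i+1) < x $ e i / v $ e i"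
begin

definition a :: "nat \<Rightarrow> real" where
  "a k = x $ e k / v $ e k"

abbreviation \<Sigma> :: "nat set \<Rightarrow> nat set \<Rightarrow> real" where
  "\<Sigma> \<equiv> Sigma_LR e v x"

lemma v_nonzero: "i \<in> {1..CARD('n)} \<Longrightarrow> v $ e i \<noteq> 0"
  using v_pos[of i] v_neg[of i] by (cases "i \<le> N") auto

lemma a_left_mono:
  assumes "i \<le> j" "1 \<le> i" "j \<le> N"
  shows "a i \<le> a j"
  using assms
proof (induction rule: dec_induct)
  case (step m)
  then show ?case
    using step_left[of m] by (simp add: a_def)
qed simp

lemma a_right_antimono:
  assumes "i \<le> j" "N + 1 \<le> i" "j \<le> CARD('n)"
  shows "a j \<le> a i"
  using assms
proof (induction rule: dec_induct)
  case (step m)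
  then show ?case
    using step_right[of m] by (simp add: a_def)
qed simp

text \<open>Dividing \<open>t * v $ j \<le> y $ j\<close> by \<open>v $ j\<close> keeps the
  inequality on the positive block and reverses it on the negative one, so a threshold between the
  right and the left quotients yields membership.\<close>

lemma mem_cone_PI:
  assumes "\<And>l. l \<in> {1..N} \<Longrightarrow> t \<le> y $ e l / v $ e l"
    and "\<And>r. r \<in> {N+1..CARD('n)} \<Longrightarrow> y $ e r / v $ e r \<le> t"
  shows "y \<in> cone_P v"
  unfolding mem_cone_P_iff
proof (intro exI allI)
  fix j
  have "j \<in> e ` {1..CARD('n)}"
    using bij by (simp add: bij_betw_def)
  then obtain k where k: "k \<in> {1..CARD('n)}" "j = e k"
    by blast
  show "t * v $ j \<le> y $ j"
  proof (cases "k \<le> N")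
    case True
    then show ?thesis
      using k v_pos[of k] assms(1)[of k] by (simp add: pos_le_divide_eq)
  next
    case False
    then show ?thesis
      using k v_neg[of k] assms(2)[of k] by (simp add: neg_divide_le_eq)
  qed
qed

section \<open>The average under insertion of an index\<close>

lemma weight_pos:
  assumes "L \<union> R \<subseteq> {1..CARD('n)}" "L \<union> R \<noteq> {}"
  shows "0 < (\<Sum>k\<in>L \<union> R. (v $ e k)\<^sup>2)"
  using assms v_nonzero finite_subset[OF assms(1)] by (intro sum_pos) auto

lemma Sigma_mult_weight:
  assumes "L \<union> R \<subseteq> {1..CARD('n)}" "L \<union> R \<noteq> {}"
  shows "\<Sigma> L R * (\<Sum>k\<in>L \<union> R. (v $ e k)\<^sup>2) = (\<Sum>k\<in>L \<union> R. x $ e k * v $ e k)"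
  using weight_pos[OF assms] by (simp add: Sigma_LR_def)

text \<open>The new average combines the old one, of weight \<open>?W\<close>, with
  \<open>a k\<close>, of weight \<open>?w\<close>. Only the union enters, so one statement serves
  growth on either side.\<close>

lemma Sigma_insert:
  assumes LR: "L \<union> R \<subseteq> {1..CARD('n)}" "L \<union> R \<noteq> {}"
    and k: "k \<in> {1..CARD('n)} - (L \<union> R)" and ins: "L' \<union> R' = insert k (L \<union> R)"
  shows "a k < \<Sigma> L R \<Longrightarrow> a k < \<Sigma> L' R' \<and> \<Sigma> L' R' < \<Sigma> L R"
    and "\<Sigma> L R < a k \<Longrightarrow> \<Sigma> L R < \<Sigma> L' R' \<and> \<Sigma> L' R' < a k"
proof -
  let ?W = "\<Sum>k\<in>L \<union> R. (v $ e k)\<^sup>2" and ?w = "(v $ e k)\<^sup>2"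
  have v: "v $ e k \<noteq> 0" and fin: "finite (L \<union> R)" and notin: "k \<notin> L \<union> R"
    using k v_nonzero finite_subset[OF LR(1)] by auto
  have "x $ e k * v $ e k = a k * ?w"
    using v by (simp add: a_def power2_eq_square)
  then have eq: "\<Sigma> L' R' = (\<Sigma> L R * ?W + a k * ?w) / (?W + ?w)"
    unfolding Sigma_LR_def[of e v x L' R'] ins sum.insert[OF fin notin] Sigma_mult_weight[OF LR]
    by (simp add: add.commute)
  have pos: "0 < ?w" "0 < ?W"
    using v weight_pos[OF LR] by auto
  show "a k < \<Sigma> L R \<Longrightarrow> a k < \<Sigma> L' R' \<and> \<Sigma> L' R' < \<Sigma> L R"
    and "\<Sigma> L R < a k \<Longrightarrow> \<Sigma> L R < \<Sigma> L' R' \<and> \<Sigma> L' R' < a k"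
    unfolding eq using weighted_average_between[OF pos] by blast+
qed

section \<open>The separation invariant\<close>

text \<open>\<open>L\<close> and \<open>R\<close> are always nonempty initial segments of their
  blocks, so their lengths \<open>p\<close> and \<open>q\<close> encode them. By monotonicity
  \<open>a p\<close> is the largest left value and \<open>a (N + q)\<close> the smallest right one,
  so comparing these two suffices.\<close>

definition separated :: "nat \<Rightarrow> nat \<Rightarrow> bool" where
  "separated p q \<longleftrightarrow> 1 \<le> p \<and> p \<le> N \<and> 1 \<le> q \<and> N + q \<le> CARD('n) \<and>
     a p < \<Sigma> {1..p} {N+1..N+q} \<and> \<Sigma> {1..p} {N+1..N+q} < a (N + q)"

lemma separated_initial:
  assumes "a 1 < a (N + 1)"
  shows "separated 1 1"
proof -
  \<comment> \<open>Starting from a one-element average makes the arrival of \<open>N + 1\<close> an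
    instance of \<open>Sigma_insert\<close>.\<close>
  have "\<Sigma> {1} {} = a 1"
    using v_nonzero[of 1] N by (simp add: Sigma_LR_def a_def power2_eq_square)
  then have "a 1 < \<Sigma> {1} {N+1}" "\<Sigma> {1} {N+1} < a (N + 1)"
    using Sigma_insert(2)[of "{1}" "{}" "N + 1" "{1}" "{N+1}"] assms N by auto
  then show ?thesis
    using N by (simp add: separated_def)
qed

text \<open>The average decreases but stays above \<open>a (p + 1)\<close>; the decrease preserves
  the bound by \<open>a (N + q)\<close>.\<close>

lemma separated_Suc_left:
  assumes "separated p q" "p + 1 \<le> N" "a (p + 1) < \<Sigma> {1..p} {N+1..N+q}"
  shows "separated (p + 1) q"
proof -
  have "{1..p+1} \<union> {N+1..N+q} = insert (p + 1) ({1..p} \<union> {N+1..N+q})"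
    by auto
  then have "a (p + 1) < \<Sigma> {1..p+1} {N+1..N+q} \<and>
      \<Sigma> {1..p+1} {N+1..N+q} < \<Sigma> {1..p} {N+1..N+q}"
    using assms by (intro Sigma_insert(1)) (auto simp: separated_def)
  then show ?thesis
    using assms unfolding separated_def by linarith
qed

lemma separated_Suc_right:
  assumes "separated p q" "N + q + 1 \<le> CARD('n)" "\<Sigma> {1..p} {N+1..N+q} < a (N + q + 1)"
  shows "separated p (q + 1)"
proof -
  have "{1..p} \<union> {N+1..N+(q+1)} = insert (N + q + 1) ({1..p} \<union> {N+1..N+q})"
    by auto
  then have "\<Sigma> {1..p} {N+1..N+q} < \<Sigma> {1..p} {N+1..N+(q+1)} \<and>
      \<Sigma> {1..p} {N+1..N+(q+1)} < a (N + q + 1)"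
    using assms by (intro Sigma_insert(2)) (auto simp: separated_def)
  then show ?thesis
    using assms unfolding separated_def by (simp add: add.assoc)
qed

lemma separated_less:
  assumes "separated p q"
  shows "l \<in> {1..p} \<Longrightarrow> a l < \<Sigma> {1..p} {N+1..N+q}"
    and "r \<in> {N+1..N+q} \<Longrightarrow> \<Sigma> {1..p} {N+1..N+q} < a r"
  using assms a_left_mono[of l p] a_right_antimono[of r "N + q"]
  by (auto simp: separated_def)

section \<open>Optimality and progress\<close>

lemma separated_closest_point:
  assumes sep: "separated p q"
    and y: "y = y_LR e v x {1..p} {N+1..N+q}" "y \<in> cone_P v"
  shows "closest_point (cone_P v) x = y"
proof (rule closest_point_eqI)
  let ?K = "{1..p} \<union> {N+1..N+q}" and ?s = "\<Sigma> {1..p} {N+1..N+q}"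
  have K: "?K \<subseteq> {1..CARD('n)}" "?K \<noteq> {}"
    using sep N by (auto simp: separated_def)
  have inj: "inj_on e ?K"
    using bij K(1) by (auto simp: bij_betw_def intro: inj_on_subset)
  have d: "(x - y) $ j = (if j \<in> e ` ?K then x $ j - v $ j * ?s else 0)" for j
    by (simp add: y y_LR_def)
  have d_nonpos: "(x - y) $ j \<le> 0" for j
  proof (cases "j \<in> e ` ?K")
    case True
    then obtain k where k: "k \<in> ?K" "j = e k" by blast
    \<comment> \<open>On the right block both the comparison with \<open>?s\<close> and the sign of
      \<open>v\<close> flip, so the two blocks give the same inequality.\<close>
    have "x $ e k \<le> v $ e k * ?s"
    proof (cases "k \<le> p")
      case True
      then have "0 < v $ e k" "a k < ?s"
        using k sep v_pos[of k] separated_less(1)[OF sep, of k] by (auto simp: separated_def)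
      then show ?thesis
        by (simp add: a_def pos_divide_less_eq mult.commute)
    next
      case False
      then have "v $ e k < 0" "?s < a k"
        using k sep v_neg[of k] separated_less(2)[OF sep, of k] by (auto simp: separated_def)
      then show ?thesis
        by (simp add: a_def neg_less_divide_eq mult.commute)
    qed
    then show ?thesis
      using k d[of j] by simp
  qed (use d[of j] in simp)
  have "inner (x - y) v = (\<Sum>j\<in>e ` ?K. (x $ j - v $ j * ?s) * v $ j)"
    unfolding inner_vec_def inner_real_def d
    by (simp add: if_distrib[of "\<lambda>u. u * _"] sum.If_cases cong: if_cong)
  also have "\<dots> = (\<Sum>k\<in>?K. x $ e k * v $ e k) - ?s * (\<Sum>k\<in>?K. (v $ e k)\<^sup>2)"
    unfolding sum.reindex[OF inj]
    by (simp add: sum_subtractf sum_distrib_left power2_eq_square algebra_simps)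
  finally have d_v: "inner (x - y) v = 0"
    using Sigma_mult_weight[OF K] by simp
  \<comment> \<open>Wherever \<open>x - y\<close> can be nonzero, \<open>y\<close> agrees with
    \<open>?s *\<^sub>R v\<close>.\<close>
  have "inner (x - y) y = inner (x - y) (?s *\<^sub>R v)"
    unfolding inner_vec_def
    by (intro sum.cong refl) (simp add: y y_LR_def mult.commute)
  then have d_y: "inner (x - y) y = 0"
    using d_v by simp
  fix z assume "z \<in> cone_P v"
  then obtain t where t: "\<And>j. t * v $ j \<le> z $ j"
    by (auto simp: mem_cone_P_iff)
  \<comment> \<open>By the two orthogonalities this inner product equals the one with
    \<open>z - y\<close>.\<close>
  have "inner (x - y) (z - t *\<^sub>R v) \<le> 0"
    unfolding inner_vec_def inner_real_def
    by (intro sum_nonpos mult_nonpos_nonneg d_nonpos) (simp add: t)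
  then show "inner (x - y) (z - y) \<le> 0"
    using d_v d_y by (simp add: inner_diff_right)
qed (rule y(2))

text \<open>If neither next candidate violates the order, monotonicity clears all later indices, and
  \<open>mem_cone_PI\<close> applies with threshold \<open>?s\<close>.\<close>

lemma separated_not_in_cone:
  assumes sep: "separated p q" and "y_LR e v x {1..p} {N+1..N+q} \<notin> cone_P v"
  shows "(p + 1 \<le> N \<and> a (p + 1) < \<Sigma> {1..p} {N+1..N+q}) \<or>
    (N + q + 1 \<le> CARD('n) \<and> \<Sigma> {1..p} {N+1..N+q} < a (N + q + 1))"
proof (rule ccontr)
  let ?s = "\<Sigma> {1..p} {N+1..N+q}" and ?y = "y_LR e v x {1..p} {N+1..N+q}"
  assume neg: "\<not> ?thesis"
  have mem: "e k \<in> e ` ({1..p} \<union> {N+1..N+q}) \<longleftrightarrow> k \<in> {1..p} \<union> {N+1..N+q}"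
    if "k \<in> {1..CARD('n)}" for k
    using that sep N bij
    by (intro inj_on_image_mem_iff[of e "{1..CARD('n)}"]) (auto simp: separated_def bij_betw_def)
  have quot: "?y $ e k / v $ e k = (if k \<in> {1..p} \<union> {N+1..N+q} then ?s else a k)"
    if "k \<in> {1..CARD('n)}" for k
    unfolding y_LR_def vec_lambda_beta mem[OF that] using v_nonzero[OF that] by (simp add: a_def)
  have "?y \<in> cone_P v"
  proof (rule mem_cone_PI)
    fix l assume l: "l \<in> {1..N}"
    show "?s \<le> ?y $ e l / v $ e l"
      using l N neg a_left_mono[of "p + 1" l] quot[of l] by auto
  next
    fix r assume r: "r \<in> {N+1..CARD('n)}"
    show "?y $ e r / v $ e r \<le> ?s"
      using r N sep neg a_right_antimono[of "N + q + 1" r] quot[of r] by (auto simp: separated_def)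
  qed
  then show False
    using assms by simp
qed

section \<open>One pass of the loop body\<close>

lemma card_L_bar_le: "card (L_bar e N v x) \<le> N"
proof -
  have "L_bar e N v x \<subseteq> {1..N}"
    by (auto simp: L_bar_def)
  from card_mono[OF _ this] show ?thesis
    by simp
qed

lemma card_R_bar_le: "N + card (R_bar e N v x) \<le> CARD('n)"
proof -
  have "R_bar e N v x \<subseteq> {N+1..CARD('n)}"
    by (auto simp: R_bar_def)
  from card_mono[OF _ this] show ?thesis
    using N by simp
qed

text \<open>Once the quotient test succeeds, the cardinality test only asks whether index
  \<open>p + 1\<close> exists: the values up to \<open>a (p + 1)\<close> lie below
  \<open>\<Sigma>\<close>, hence below \<open>a (N + 1)\<close>, which puts their indices into
  \<open>L_bar\<close>.\<close>

lemma less_card_L_bar_iff: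
  assumes sep: "separated p q" and less: "a (p + 1) < \<Sigma> {1..p} {N+1..N+q}"
  shows "p < card (L_bar e N v x) \<longleftrightarrow> p + 1 \<le> N"
proof
  assume le: "p + 1 \<le> N"
  have "{1..p+1} \<subseteq> L_bar e N v x"
  proof
    fix l assume l: "l \<in> {1..p+1}"
    have "\<Sigma> {1..p} {N+1..N+q} < a (N + 1)"
      using sep separated_less(2)[OF sep, of "N + 1"] by (auto simp: separated_def)
    then have "a l < a (N + 1)"
      using l le less a_left_mono[of l "p + 1"] by auto
    then show "l \<in> L_bar e N v x"
      using l le N by (auto simp: L_bar_def a_def intro!: bexI[of _ "N + 1"])
  qed
  from card_mono[OF _ this] show "p < card (L_bar e N v x)"
    by (simp add: L_bar_def)
qed (use card_L_bar_le in simp)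

lemma less_card_R_bar_iff:
  assumes sep: "separated p q" and less: "\<Sigma> {1..p} {N+1..N+q} < a (N + q + 1)"
  shows "q < card (R_bar e N v x) \<longleftrightarrow> N + q + 1 \<le> CARD('n)"
proof
  assume le: "N + q + 1 \<le> CARD('n)"
  have "{N+1..N+q+1} \<subseteq> R_bar e N v x"
  proof
    fix r assume r: "r \<in> {N+1..N+q+1}"
    have "a 1 < \<Sigma> {1..p} {N+1..N+q}"
      using sep separated_less(1)[OF sep, of 1] by (auto simp: separated_def)
    then have "a 1 < a r"
      using r le less a_right_antimono[of r "N + q + 1"] by auto
    then show "r \<in> R_bar e N v x"
      using r le N by (auto simp: R_bar_def a_def intro!: bexI[of _ 1])
  qed
  from card_mono[OF _ this] show "q < card (R_bar e N v x)"
    by (simp add: R_bar_def)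
qed (use card_R_bar_le in simp)

lemma proj_step_separated:
  assumes sep: "separated p q"
  obtains p' q' where
    "proj_step e N v x (y, {1..p}, {N+1..N+q}) =
      (y_LR e v x {1..p} {N+1..N+q}, {1..p'}, {N+1..N+q'})"
    "separated p' q'"
    "y_LR e v x {1..p} {N+1..N+q} \<in> cone_P v \<or> p + q < p' + q'"
proof -
  let ?s = "\<Sigma> {1..p} {N+1..N+q}" and ?y = "y_LR e v x {1..p} {N+1..N+q}"
  define p' where "p' = (if p + 1 \<le> N \<and> a (p + 1) < ?s then p + 1 else p)"
  define q' where
    "q' = (if N + q + 1 \<le> CARD('n) \<and> \<Sigma> {1..p'} {N+1..N+q} < a (N + q + 1) then q + 1 else q)"
  have sep': "separated p' q"
    using sep separated_Suc_left[OF sep] by (simp add: p'_def)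
  then have sep'': "separated p' q'"
    using separated_Suc_right[OF sep'] by (simp add: q'_def)
  have L: "(if p < card (L_bar e N v x) \<and> a (p + 1) < ?s then {1..p} \<union> {p + 1} else {1..p})
      = {1..p'}"
    using less_card_L_bar_iff[OF sep] by (auto simp: p'_def)
  have R: "(if q < card (R_bar e N v x) \<and> a (N + q + 1) > \<Sigma> {1..p'} {N+1..N+q}
      then {N+1..N+q} \<union> {N + q + 1} else {N+1..N+q}) = {N+1..N+q'}"
    \<comment> \<open>The second test sees the updated left segment, hence \<open>sep'\<close>
      rather than \<open>sep\<close>.\<close>
    using less_card_R_bar_iff[OF sep'] by (auto simp: q'_def)
  have cards: "card {1..p} = p" "card {N+1..N+q} = q"
    by auto
  have "proj_step e N v x (y, {1..p}, {N+1..N+q}) = (?y, {1..p'}, {N+1..N+q'})"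
    unfolding proj_step_def Let_def prod.case cards a_def[symmetric] L R by (rule refl)
  \<comment> \<open>If the left segment did not grow, the second test uses the same average
    \<open>?s\<close> as \<open>separated_not_in_cone\<close>.\<close>
  moreover have "?y \<in> cone_P v \<or> p + q < p' + q'"
    using separated_not_in_cone[OF sep] by (auto simp: p'_def q'_def)
  ultimately show ?thesis
    using that sep'' by blast
qed

section \<open>Termination and correctness of the loop\<close>

text \<open>The vector lags behind the sets: it is \<open>x\<close> at first and later comes from
  the sets before their update. Hence \<open>y\<close> is not tied to the current \<open>L\<close>
  and \<open>R\<close>.\<close>

definition loop_inv :: "(real ^ 'n) \<times> nat set \<times> nat set \<Rightarrow> bool" where
  "loop_inv = (\<lambda>(y, L, R). (\<exists>p q. separated p q \<and> L = {1..p} \<and> R = {N+1..N+q}) \<and>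
     (y \<in> cone_P v \<longrightarrow> closest_point (cone_P v) x = y))"

text \<open>The value 0 inside the cone covers a final pass that enlarges neither set; the
  \<open>+ 1\<close> keeps the measure positive outside, as \<open>card L + card R\<close> can reach
  \<open>CARD('n)\<close>.\<close>

definition loop_measure :: "(real ^ 'n) \<times> nat set \<times> nat set \<Rightarrow> nat" where
  "loop_measure =
     (\<lambda>(y, L, R). if y \<in> cone_P v then 0 else CARD('n) + 1 - (card L + card R))"

lemma loop_step:
  assumes "loop_inv s" and "case s of (y, L, R) \<Rightarrow> y \<notin> cone_P v"
  shows "loop_inv (proj_step e N v x s) \<and> loop_measure (proj_step e N v x s) < loop_measure s"
proof -
  obtain y p q where s: "s = (y, {1..p}, {N+1..N+q})" and sep: "separated p q"
    and y: "y \<notin> cone_P v"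
    using assms by (auto simp: loop_inv_def)
  obtain p' q' where step: "proj_step e N v x s =
      (y_LR e v x {1..p} {N+1..N+q}, {1..p'}, {N+1..N+q'})"
    and sep': "separated p' q'"
    and grow: "y_LR e v x {1..p} {N+1..N+q} \<in> cone_P v \<or> p + q < p' + q'"
    using proj_step_separated[OF sep, of y] unfolding s by metis
  have "loop_inv (proj_step e N v x s)"
    unfolding step loop_inv_def using sep' separated_closest_point[OF sep refl] by auto
  moreover have "p + q \<le> CARD('n)" "p' + q' \<le> CARD('n)"
    using sep sep' by (auto simp: separated_def)
  then have "loop_measure (proj_step e N v x s) < loop_measure s"
    using grow y unfolding step unfolding s loop_measure_def by auto
  ultimately show ?thesis ..
qed

lemma projection_algorithm_correct:
  "projection_algorithm e N v x = Some (closest_point (cone_P v) x)"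
proof (cases "x \<in> cone_P v")
  case True
  then show ?thesis
    by (simp add: projection_algorithm_def while_option_unfold closest_point_self)
next
  case False
  let ?b = "\<lambda>(y, L :: nat set, R :: nat set). y \<notin> cone_P v"
    and ?s = "(x, {1}, {N+1})"
  \<comment> \<open>These are the smallest left and the largest right quotient; in the opposite
    order \<open>a 1\<close> is a threshold showing that \<open>x\<close> is in the cone.\<close>
  have "a 1 < a (N + 1)"
  proof (rule ccontr)
    assume "\<not> a 1 < a (N + 1)"
    then have "x \<in> cone_P v"
      using a_left_mono[of 1] a_right_antimono[of "N + 1"]
      by (intro mem_cone_PI[of "a 1"]) (fastforce simp: a_def)+
    then show False
      using False by simp
  qed
  then have "separated 1 1"
    by (rule separated_initial)
  then have inv: "loop_inv ?s"
    using False by (auto simp: loop_inv_def intro!: exI[of _ 1])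
  obtain y L R where run: "while_option ?b (proj_step e N v x) ?s = Some (y, L, R)"
    using measure_while_option_Some[where P = loop_inv and b = ?b and f = loop_measure,
        OF loop_step inv] by auto
  have "loop_inv (y, L, R)"
    using while_option_rule[where P = loop_inv, OF _ run inv] loop_step by blast
  then have "closest_point (cone_P v) x = y"
    using while_option_stop[OF run] by (simp add: loop_inv_def)
  then show ?thesis
    using run by (simp add: projection_algorithm_def)
qed

end

theorem theorem8:
  fixes e :: "nat \<Rightarrow> 'n::finite" and N :: nat and v x :: "real ^ 'n"
  assumes "bij_betw e {1..CARD('n)} (UNIV :: 'n set)"
    and "CARD('n) \<ge> 2"
    and "N \<in> {1..CARD('n) - 1}"
    and "\<forall>i\<in>{1..N}. v $ e i > 0"
    and "\<forall>i\<in>{N+1..CARD('n)}. v $ e i < 0"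
    and "\<forall>i\<in>{1..<N}. x $ e i / v $ e i < x $ e (i+1) / v $ e (i+1)"
    and "\<forall>i\<in>{N+1..<CARD('n)}. x $ e (i+1) / v $ e (i+1) < x $ e i / v $ e i"
  shows "\<exists>y. projection_algorithm e N v x = Some y \<and> y = closest_point (cone_P v) x"
proof -
  interpret projection_input e N v x
    using assms by unfold_locales auto
  show ?thesis
    using projection_algorithm_correct by blast
qed

end
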